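(* Let $b\in\mathbb{Z}$ with $|b|\ge 3$. Let $\mathcal{D}\subset\mathbb{Z}$ be a complete residue system modulo $b$ (exactly one element in each residue class) such that (i) $|d|\le |b|$ for all $d\in\mathcal{D}$; (ii) $1\in\mathcal{D}$ or $-1\in\mathcal{D}$; (iii) $b-1\notin\mathcal{D}$ and $-b+1\notin\mathcal{D}$. Then $(\mathbb{Z},b,\mathcal{D})$ is a number system.
   Context: For an integer $b$ with $|b|\ge 2$ and a complete residue system $\mathcal{D}$ modulo $b$, $(\mathbb{Z},b,\mathcal{D})$ is a number system if every $a\in\mathbb{Z}$ can be written as $a=\sum_{i=0}^{\ell-1}d_ib^i$ with $\ell\ge 1$ and all $d_i\in\mathcal{D}$. *)

theory Defs
  imports "HOL-Number_Theory.Cong"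
begin

text \<open>The modulus may be negative; \<^const>\<open>cong\<close> on \<^typ>\<open>int\<close> is then
  congruence modulo its absolute value, as usual.\<close>

definition complete_residue_system :: "int \<Rightarrow> int set \<Rightarrow> bool" where
  "complete_residue_system b D \<longleftrightarrow> (\<forall>a. \<exists>!d. d \<in> D \<and> [d = a] (mod b))"

definition number_system :: "int \<Rightarrow> int set \<Rightarrow> bool" where
  "number_system b D \<longleftrightarrow>
     \<bar>b\<bar> \<ge> 2 \<and> complete_residue_system b D \<and>
     (\<forall>a. \<exists>l d. l \<ge> 1 \<and> (\<forall>i<l. d i \<in> D) \<and> a = (\<Sum>i<l. d i * b ^ i))"

end

theory Submission
  imports Defs
begin

text \<open>Writing \<open>a = d + b q\<close> with \<open>d \<in> D\<close>, the bound on the digits gives \<open>\<bar>q\<bar> < \<bar>a\<bar>\<close> as soon as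
  \<open>\<bar>a\<bar> \<ge> 2\<close>, and \<open>\<bar>q\<bar> \<le> 1\<close> when \<open>\<bar>a\<bar> \<le> 1\<close>. So everything reduces to representing \<open>-1, 0, 1\<close>.
  If \<open>e = \<plusminus>1\<close> is a digit, then \<open>-e\<close> has quotient \<open>0\<close> or \<open>e\<close>: the quotient \<open>-e\<close> would make
  \<open>e (b - 1)\<close> a digit. Finally \<open>0\<close> is a digit or has quotient \<open>\<plusminus>1\<close>.\<close>

definition representable :: "int \<Rightarrow> int set \<Rightarrow> int \<Rightarrow> bool" where
  "representable b D a \<longleftrightarrow> (\<exists>l d. l \<ge> 1 \<and> (\<forall>i<l. d i \<in> D) \<and> a = (\<Sum>i<l. d i * b ^ i))"

lemma representable_digit: "representable b D a" if "a \<in> D"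
  unfolding representable_def
  by (rule exI[of _ 1], rule exI[of _ "\<lambda>_. a"]) (simp add: that)

lemma representable_step:
  assumes "c \<in> D" and "representable b D q"
  shows "representable b D (c + b * q)"
proof -
  obtain l d where l: "l \<ge> 1" and d: "\<forall>i<l. d i \<in> D" and q: "q = (\<Sum>i<l. d i * b ^ i)"
    using assms(2) unfolding representable_def by blast
  \<comment> \<open>\<open>case_nat c d\<close> puts \<open>c\<close> at the lowest place and moves
    each digit of \<open>q\<close> up by one, matching the factor \<open>b\<close>.\<close>
  have "c + b * q = (\<Sum>i<Suc l. case_nat c d i * b ^ i)"
    unfolding q sum.lessThan_Suc_shift by (simp add: sum_distrib_left mult.left_commute)
  moreover have "\<forall>i<Suc l. case_nat c d i \<in> D"
    using assms(1) d by (auto split: nat.split)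
  ultimately show ?thesis
    unfolding representable_def by (intro exI[of _ "Suc l"] exI[of _ "case_nat c d"]) simp
qed

lemma complete_residue_system_division:
  assumes "complete_residue_system b D"
  obtains d q where "d \<in> D" and "a = d + b * q"
proof -
  obtain d where d: "d \<in> D" "[d = a] (mod b)"
    using assms unfolding complete_residue_system_def by blast
  then obtain q where "a = d + b * q"
    using cong_iff_lin by blast
  with d(1) that show ?thesis by blast
qed

text \<open>Since \<open>b * q = a - d\<close>, the triangle inequality bounds its absolute value
  strictly below twice that of \<open>b\<close>.\<close>

lemma abs_quotient_le_one:
  fixes a b d q :: int
  assumes "a = d + b * q" and "\<bar>d\<bar> \<le> \<bar>b\<bar>" and "\<bar>a\<bar> < \<bar>b\<bar>"
  shows "\<bar>q\<bar> \<le> 1"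
proof -
  have "\<bar>b\<bar> * \<bar>q\<bar> < \<bar>b\<bar> * 2"
    using assms by (simp flip: abs_mult)
  then show ?thesis by (simp add: mult_less_cancel_left)
qed

text \<open>The triangle inequality for \<open>b * q = a - d\<close> gives
  \<open>\<bar>b\<bar> * (\<bar>q\<bar> - 1) \<le> \<bar>a\<bar>\<close>. A quotient no smaller than
  \<open>a\<close> would then force \<open>3 * (\<bar>a\<bar> - 1) \<le> \<bar>a\<bar>\<close>,
  which fails from \<open>\<bar>a\<bar> = 2\<close> on.\<close>

lemma abs_quotient_less:
  fixes a b d q :: int
  assumes "a = d + b * q" and "\<bar>d\<bar> \<le> \<bar>b\<bar>" and "\<bar>b\<bar> \<ge> 3" and "\<bar>a\<bar> \<ge> 2"
  shows "\<bar>q\<bar> < \<bar>a\<bar>"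
proof (rule ccontr)
  assume "\<not> \<bar>q\<bar> < \<bar>a\<bar>"
  have "3 * (\<bar>a\<bar> - 1) \<le> \<bar>b\<bar> * (\<bar>a\<bar> - 1)"
    using assms(3,4) by (intro mult_right_mono) auto
  also have "\<dots> \<le> \<bar>b\<bar> * (\<bar>q\<bar> - 1)"
    using \<open>\<not> \<bar>q\<bar> < \<bar>a\<bar>\<close> by (intro mult_left_mono) auto
  also have "\<dots> \<le> \<bar>a\<bar>"
    using assms(1,2) by (simp add: right_diff_distrib flip: abs_mult)
  finally show False using assms(4) by simp
qed

theorem theorem2p13:
  fixes b :: int and D :: "int set"
  assumes "\<bar>b\<bar> \<ge> 3"
    and "complete_residue_system b D"
    and "\<forall>d\<in>D. \<bar>d\<bar> \<le> \<bar>b\<bar>"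
    and "1 \<in> D \<or> -1 \<in> D"
    and "b - 1 \<notin> D" and "-b + 1 \<notin> D"
  shows "number_system b D"
proof -
  let ?R = "representable b D"
  have division: "\<exists>d q. d \<in> D \<and> a = d + b * q \<and> \<bar>d\<bar> \<le> \<bar>b\<bar>" for a
    using complete_residue_system_division[OF assms(2)] assms(3) by metis
  obtain e where e: "e \<in> D" "e = 1 \<or> e = -1"
    using assms(4) by blast
  have pos: "?R e" using e(1) by (rule representable_digit)
  have neg: "?R (-e)"
  proof -
    obtain d q where d: "d \<in> D" "-e = d + b * q" "\<bar>d\<bar> \<le> \<bar>b\<bar>"
      using division by blast
    have "\<bar>q\<bar> \<le> 1"
      using d(2,3) by (rule abs_quotient_le_one) (use e(2) assms(1) in auto)
    then consider "q = 0" | "q = e" | "q = -e" using e(2) by linarith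
    then show ?thesis
    proof cases
      case 1
      then show ?thesis using d(1,2) by (auto intro: representable_digit)
    next
      case 2
      then show ?thesis using representable_step[OF d(1) pos] d(2) by simp
    next
      case 3
      \<comment> \<open>According to the sign of \<open>e\<close>, this is \<open>b - 1\<close> or
        \<open>-b + 1\<close>, and neither is a digit.\<close>
      then have "d = e * (b - 1)" using d(2) by algebra
      then show ?thesis using e(2) d(1) assms(5,6) by auto
    qed
  qed
  have unit: "?R a" if "\<bar>a\<bar> = 1" for a
  proof -
    have "a = e \<or> a = -e" using that e(2) by linarith
    then show ?thesis using pos neg by blast
  qed
  \<comment> \<open>The empty sum is ruled out by \<open>l \<ge> 1\<close>, and 0 may fail to be a
    digit, so it needs an expansion of its own.\<close>
  have zero: "?R 0"
  proof -
    obtain d q where d: "d \<in> D" "0 = d + b * q" "\<bar>d\<bar> \<le> \<bar>b\<bar>"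
      using division by blast
    have "\<bar>q\<bar> \<le> 1"
      using d(2,3) by (rule abs_quotient_le_one) (use assms(1) in auto)
    then consider "q = 0" | "\<bar>q\<bar> = 1" by linarith
    then show ?thesis
    proof cases
      case 1
      then show ?thesis using d(1,2) by (auto intro: representable_digit)
    next
      case 2
      then show ?thesis using representable_step[OF d(1) unit[OF 2]] d(2) by simp
    qed
  qed
  have "?R a" for a
  proof (induction "nat \<bar>a\<bar>" arbitrary: a rule: less_induct)
    case less
    \<comment> \<open>The first two cases are base cases, because there the quotient need not be
      smaller than \<open>a\<close> in absolute value.\<close>
    consider "a = 0" | "\<bar>a\<bar> = 1" | "\<bar>a\<bar> \<ge> 2" by linarith
    then show ?case
    proof cases
      case 1
      then show ?thesis using zero by simp
    next
      case 2
      then show ?thesis by (rule unit)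
    next
      case 3
      obtain d q where d: "d \<in> D" "a = d + b * q" "\<bar>d\<bar> \<le> \<bar>b\<bar>"
        using division by blast
      have "\<bar>q\<bar> < \<bar>a\<bar>" using d(2,3) assms(1) 3 by (rule abs_quotient_less)
      then have "?R q" by (intro less) auto
      then show ?thesis using representable_step[OF d(1)] d(2) by simp
    qed
  qed
  then show ?thesis
    using assms(1,2) unfolding number_system_def representable_def by auto
qed

end
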